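(* Let a (continuous) fibration of $\mathbb R^n$ by oriented affine $k$-planes be given. If the fibration is locally skew, then it is (globally) skew, i.e. no two distinct fibers contain parallel lines.
   Context: A fibration of an open set $T\subset\mathbb R^n$ by oriented affine $k$-planes is a family of pairwise disjoint oriented affine $k$-dimensional planes with union $T$ such that the map $\pi\colon T\to G_k(n)$, sending $x$ to the oriented linear $k$-plane parallel to the fiber through $x$, is continuous, and the map sending $x$ to its fiber (as an element of the affine Grassmannian) is continuous. Two oriented affine $k$-planes are skew if they are disjoint and do not contain parallel lines (i.e. their linear translates intersect only in $0$); a fibration is skew if any two distinct fibers are skew (two distinct fibers never contain parallel lines). A fibration of $\mathbb R^n$ is locally skew if every point of $\mathbb R^n$ has an open neighborhood $N$ such that any two distinct fibers meeting $N$ contain no parallel lines. *)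

theory Defs
  imports "HOL-Analysis.Analysis"
begin

text \<open>Points of R^n are vectors real^'n. An oriented affine k-plane is represented by a
point p on it and a frame f :: 'k => real^'n (k = CARD('k)), i.e. k linearly independent
vectors spanning the direction space; the orientation is the one induced by the frame.\<close>

definition is_frame :: "('k::finite \<Rightarrow> real^'n) \<Rightarrow> bool" where
  "is_frame f \<longleftrightarrow> inj f \<and> independent (range f)"

definition aplane :: "real^'n \<Rightarrow> ('k::finite \<Rightarrow> real^'n) \<Rightarrow> (real^'n) set" where
  "aplane p f = (\<lambda>v. p + v) ` span (range f)"

text \<open>Normalised Pluecker embedding of the oriented linear k-plane spanned by the frame f,
as the unit alternating k-form w |-> det(f_i . w_j) / sqrt(det Gram(f)). It depends only on
the oriented plane and is injective on oriented planes; the topology of the oriented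
Grassmannian G_k(n) is the one induced from this (finite-dimensional) embedding.\<close>

definition plucker :: "('k::finite \<Rightarrow> real^'n) \<Rightarrow> ('k \<Rightarrow> real^'n) \<Rightarrow> real" where
  "plucker f w = det ((\<chi> i j. f i \<bullet> w j) :: real^'k^'k) / sqrt (det ((\<chi> i j. f i \<bullet> f j) :: real^'k^'k))"

text \<open>A (continuous) fibration of R^n by oriented affine k-planes, given by assigning to each
x the fiber through x, namely the oriented plane aplane x (F x).  Continuity into the
affine Grassmannian is continuity of the direction (Pluecker coordinates) together with
continuity of the foot point (closest point of the fiber to the origin).\<close>

definition fibration :: "(real^'n \<Rightarrow> 'k::finite \<Rightarrow> real^'n) \<Rightarrow> bool" where
  "fibration F \<longleftrightarrow>
     (\<forall>x. is_frame (F x)) \<and>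
     (\<forall>x y. aplane x (F x) \<inter> aplane y (F y) \<noteq> {} \<longrightarrow>
              aplane x (F x) = aplane y (F y) \<and> plucker (F x) = plucker (F y)) \<and>
     (\<forall>w. continuous_on UNIV (\<lambda>x. plucker (F x) w)) \<and>
     continuous_on UNIV (\<lambda>x. closest_point (aplane x (F x)) 0)"

definition no_parallel_lines :: "('k::finite \<Rightarrow> real^'n) \<Rightarrow> ('k \<Rightarrow> real^'n) \<Rightarrow> bool" where
  "no_parallel_lines f g \<longleftrightarrow> span (range f) \<inter> span (range g) = {0}"

definition locally_skew :: "(real^'n \<Rightarrow> 'k::finite \<Rightarrow> real^'n) \<Rightarrow> bool" where
  "locally_skew F \<longleftrightarrow>
     (\<forall>p. \<exists>N. open N \<and> p \<in> N \<and>
        (\<forall>x\<in>N. \<forall>y\<in>N. aplane x (F x) \<noteq> aplane y (F y) \<longrightarrow> no_parallel_lines (F x) (F y)))"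

definition skew_fibration :: "(real^'n \<Rightarrow> 'k::finite \<Rightarrow> real^'n) \<Rightarrow> bool" where
  "skew_fibration F \<longleftrightarrow>
     (\<forall>x y. aplane x (F x) \<noteq> aplane y (F y) \<longrightarrow>
        aplane x (F x) \<inter> aplane y (F y) = {} \<and> no_parallel_lines (F x) (F y))"

end

theory Submission
  imports Defs
begin

text \<open>Let \<open>foot x\<close> be the foot point of the fiber through \<open>x\<close>. For \<open>t > 0\<close> the maps
  \<open>x \<mapsto> t foot x + (x - foot x)\<close> are injective, because dividing by \<open>t\<close> turns a coincidence of
  values into a common point of two fibers. For \<open>t \<rightarrow> 0\<close> they converge locally uniformly to
  \<open>h x = x - foot x\<close>, and two fibers parallel along \<open>u \<noteq> 0\<close> provide two distinct solutions of
  \<open>h x = u\<close>. By local skewness these solutions are isolated, so a Hurwitz-type argument gives,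
  for small \<open>t\<close>, solutions of the perturbed equation near each of them, contradicting
  injectivity.\<close>

text \<open>Invariance of domain makes the image of the open ball open, and compactness makes the
  complement of the image of the closed ball open. Off the image of the sphere these two disjoint
  open sets cover everything, so \<open>C\<close> cannot pass from one to the other.\<close>

lemma connected_subset_inj_image_ball:
  fixes f :: "'a::euclidean_space \<Rightarrow> 'a"
  assumes cont: "continuous_on (cball a r) f" and inj: "inj_on f (cball a r)"
    and "connected C" and disj: "C \<inter> f ` sphere a r = {}" and ne: "C \<inter> f ` ball a r \<noteq> {}"
  shows "C \<subseteq> f ` ball a r"
proof -
  define U where "U = f ` ball a r"
  define S where "S = f ` sphere a r"
  have "open U"
    unfolding U_def using cont inj ball_subset_cball
    by (meson continuous_on_subset inj_on_subset invariance_of_domain open_ball)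
  have "f ` cball a r = U \<union> S"
    unfolding U_def S_def image_Un[symmetric] by (rule arg_cong[where f="image f"]) auto
  then have "open (- (U \<union> S))"
    using cont compact_cball compact_continuous_image compact_imp_closed by (metis open_Compl)
  have "C \<subseteq> U \<union> - (U \<union> S)"
    using disj unfolding S_def by blast
  then have "C \<inter> - (U \<union> S) = {}"
    using connectedD[OF \<open>connected C\<close> \<open>open U\<close> \<open>open (- (U \<union> S))\<close>] ne unfolding U_def by blast
  with \<open>C \<subseteq> U \<union> - (U \<union> S)\<close> show ?thesis
    unfolding U_def by blast
qed

lemma eventually_value_in_image_ball:
  fixes f :: "'i \<Rightarrow> 'a::euclidean_space \<Rightarrow> 'a"
  assumes lim: "uniform_limit (cball a r) f h G"
    and f: "\<forall>\<^sub>F t in G. continuous_on (cball a r) (f t) \<and> inj_on (f t) (cball a r)"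
    and h: "continuous_on (cball a r) h" and "r > 0"
    and bd: "\<And>y. y \<in> sphere a r \<Longrightarrow> h y \<noteq> h a"
  shows "\<forall>\<^sub>F t in G. h a \<in> f t ` ball a r"
proof -
  have "compact (h ` sphere a r)"
    using h by (intro compact_continuous_image) (auto intro: continuous_on_subset)
  moreover have "h a \<notin> h ` sphere a r"
    using bd by fastforce
  ultimately have "\<exists>d>0. \<forall>z\<in>h ` sphere a r. d \<le> dist (h a) z"
    by (intro separate_point_closed compact_imp_closed)
  then obtain d where "d > 0" and d: "\<And>y. y \<in> sphere a r \<Longrightarrow> d \<le> dist (h a) (h y)"
    by auto
  have "\<forall>\<^sub>F t in G. \<forall>y\<in>cball a r. dist (f t y) (h y) < d / 2"
    using lim \<open>d > 0\<close> by (intro uniform_limitD) simp_all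
  with f show ?thesis
  proof eventually_elim
    case (elim t)
    have "ball (h a) (d / 2) \<inter> f t ` sphere a r = {}"
    proof (intro equals0I)
      fix z assume "z \<in> ball (h a) (d / 2) \<inter> f t ` sphere a r"
      then obtain y where y: "y \<in> sphere a r" "dist (h a) (f t y) < d / 2"
        by auto
      moreover have "dist (f t y) (h y) < d / 2"
        using elim y sphere_cball by blast
      ultimately show False
        using d[OF y(1)] dist_triangle[of "h a" "h y" "f t y"] by linarith
    qed
    \<comment> \<open>The center \<open>a\<close> itself witnesses that the small ball meets the
      image of the open ball.\<close>
    moreover have "f t a \<in> ball (h a) (d / 2) \<inter> f t ` ball a r"
      using elim \<open>r > 0\<close> by (simp add: dist_commute)
    ultimately have "ball (h a) (d / 2) \<subseteq> f t ` ball a r"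
      using elim by (intro connected_subset_inj_image_ball) auto
    then show ?case
      using \<open>d > 0\<close> by auto
  qed
qed

lemma closed_aplane: "closed (aplane p f)"
  unfolding aplane_def by (intro closed_translation closed_subspace subspace_span)

lemma aplane_base: "p \<in> aplane p f"
  unfolding aplane_def using span_zero by force

lemma diff_in_aplane:
  assumes "a \<in> aplane p f" "b \<in> aplane p f"
  shows "a - b \<in> span (range f)"
  using assms unfolding aplane_def by (auto simp: span_diff)

lemma add_in_aplane:
  assumes "a \<in> aplane p f" "v \<in> span (range f)"
  shows "a + v \<in> aplane p f"
  using assms unfolding aplane_def by (auto simp: add.assoc span_add)

text \<open>A choice of base point that depends only on the fiber and, for a fibration, varies
  continuously with \<open>x\<close>.\<close>

definition foot :: "(real^'n \<Rightarrow> 'k::finite \<Rightarrow> real^'n) \<Rightarrow> real^'n \<Rightarrow> real^'n" where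
  "foot F x = closest_point (aplane x (F x)) 0"

lemma foot_in_aplane: "foot F x \<in> aplane x (F x)"
  unfolding foot_def using closed_aplane aplane_base by (metis closest_point_in_set empty_iff)

lemma diff_foot_in_span: "x - foot F x \<in> span (range (F x))"
  using aplane_base foot_in_aplane by (rule diff_in_aplane)

lemma fibration_aplane_eqI:
  assumes "fibration F" "z \<in> aplane x (F x)" "z \<in> aplane y (F y)"
  shows "aplane x (F x) = aplane y (F y)"
  using assms unfolding fibration_def by blast

lemma fibration_foot_eq:
  assumes "fibration F" "z \<in> aplane x (F x)"
  shows "foot F z = foot F x"
  unfolding foot_def fibration_aplane_eqI[OF assms aplane_base] ..

lemma fibration_inj_scaled_foot:
  fixes F :: "real^'n \<Rightarrow> 'k::finite \<Rightarrow> real^'n"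
  assumes "fibration F" "t > 0"
  shows "inj (\<lambda>x. t *\<^sub>R foot F x + (x - foot F x))"
proof (rule injI)
  fix x y
  assume eq: "t *\<^sub>R foot F x + (x - foot F x) = t *\<^sub>R foot F y + (y - foot F y)"
  have "z + (1 / t) *\<^sub>R v = (1 / t) *\<^sub>R (t *\<^sub>R z + v)" for z v :: "real^'n"
    using \<open>t > 0\<close> by (simp add: scaleR_add_right)
  then have "foot F x + (1 / t) *\<^sub>R (x - foot F x) = foot F y + (1 / t) *\<^sub>R (y - foot F y)"
    using eq by simp
  \<comment> \<open>Rescaling the displacement from the foot point stays within the fiber, so equal
    values for \<open>x\<close> and \<open>y\<close> yield a point common to both fibers.\<close>
  moreover have "foot F z + (1 / t) *\<^sub>R (z - foot F z) \<in> aplane z (F z)" for z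
    by (intro add_in_aplane foot_in_aplane span_scale diff_foot_in_span)
  ultimately have "aplane x (F x) = aplane y (F y)"
    using fibration_aplane_eqI[OF assms(1)] by metis
  then have "foot F x = foot F y"
    by (simp add: foot_def)
  with eq show "x = y" by simp
qed

theorem theorem1p2:
  fixes F :: "real^'n \<Rightarrow> 'k::finite \<Rightarrow> real^'n"
  assumes "fibration F"
    and "locally_skew F"
  shows "skew_fibration F"
proof -
  define g where "g = (\<lambda>t x. t *\<^sub>R foot F x + (x - foot F x))"
  define h where "h = (\<lambda>x. x - foot F x)"
  have foot_cont: "continuous_on S (foot F)" for S
    using assms(1) unfolding fibration_def foot_def[abs_def]
    by (meson continuous_on_subset subset_UNIV)
  have h_cont: "continuous_on S h" for S
    unfolding h_def by (intro continuous_intros foot_cont)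
  have g_cont: "continuous_on S (g t)" for S t
    unfolding g_def by (intro continuous_intros foot_cont)
  have g_inj: "inj (g t)" if "t > 0" for t
    unfolding g_def using assms(1) that by (rule fibration_inj_scaled_foot)
  have g_lim: "uniform_limit (cball a r) g h (at_right 0)" for a r
  proof -
    have "bounded (foot F ` cball a r)"
      using foot_cont compact_cball compact_continuous_image compact_imp_bounded by blast
    moreover have "uniform_limit (cball a r) (\<lambda>t x. t) (\<lambda>x. 0 :: real) (at_right 0)"
      by (intro uniform_limitI) (auto simp: eventually_at)
    \<comment> \<open>Boundedness of \<open>foot F\<close> on the compact ball makes the convergence
      to 0 uniform.\<close>
    ultimately have "uniform_limit (cball a r) (\<lambda>t x. t *\<^sub>R foot F x) (\<lambda>x. 0 *\<^sub>R foot F x) (at_right 0)"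
      by (intro bounded_bilinear.bounded_uniform_limit[OF bounded_bilinear_scaleR] uniform_limit_const)
        (auto simp: bounded_iff)
    then have "uniform_limit (cball a r) (\<lambda>t x. t *\<^sub>R foot F x + (x - foot F x))
        (\<lambda>x. 0 *\<^sub>R foot F x + (x - foot F x)) (at_right 0)"
      by (intro uniform_limit_add uniform_limit_const)
    then show ?thesis by (simp add: g_def h_def)
  qed
  have isolated: "\<exists>e>0. \<forall>y\<in>cball a e. h y = h a \<longrightarrow> y = a" if "h a \<noteq> 0" for a
  proof -
    obtain N where "open N" "a \<in> N" and N: "\<And>x y. \<lbrakk>x \<in> N; y \<in> N; aplane x (F x) \<noteq> aplane y (F y)\<rbrakk>
        \<Longrightarrow> no_parallel_lines (F x) (F y)"
      using assms(2) unfolding locally_skew_def by meson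
    obtain e where "e > 0" "cball a e \<subseteq> N"
      using \<open>open N\<close> \<open>a \<in> N\<close> open_contains_cball by blast
    moreover have "y = a" if "y \<in> N" "h y = h a" for y
    proof -
      \<comment> \<open>The common value is a nonzero direction of both fibers, so local skewness
        forces the fibers, hence their foot points, to coincide.\<close>
      have "h a \<in> span (range (F a)) \<inter> span (range (F y))"
        using diff_foot_in_span[of a F] diff_foot_in_span[of y F] that by (simp add: h_def)
      with \<open>h a \<noteq> 0\<close> have "aplane a (F a) = aplane y (F y)"
        using N[OF \<open>a \<in> N\<close> \<open>y \<in> N\<close>] unfolding no_parallel_lines_def by blast
      then show ?thesis
        using that by (simp add: h_def foot_def)
    qed
    ultimately show ?thesis by blast
  qed
  have hits: "\<forall>\<^sub>F t in at_right 0. h a \<in> g t ` ball a r"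
    if "r > 0" "\<forall>y\<in>cball a r. h y = h a \<longrightarrow> y = a" for a r
  proof (rule eventually_value_in_image_ball[OF g_lim _ h_cont \<open>r > 0\<close>])
    show "\<forall>\<^sub>F t in at_right 0. continuous_on (cball a r) (g t) \<and> inj_on (g t) (cball a r)"
      using eventually_at_right_less[of "0::real"]
      by eventually_elim (use g_cont g_inj in \<open>auto intro: inj_on_subset\<close>)
    show "h y \<noteq> h a" if "y \<in> sphere a r" for y
      using that \<open>r > 0\<close> \<open>\<forall>y\<in>cball a r. h y = h a \<longrightarrow> y = a\<close> by force
  qed
  have h_inj: "a = b" if eq: "h a = h b" and nz: "h a \<noteq> 0" for a b
  proof (rule ccontr)
    assume "a \<noteq> b"
    obtain e1 where "e1 > 0" and e1: "\<forall>y\<in>cball a e1. h y = h a \<longrightarrow> y = a"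
      using isolated[OF nz] by blast
    obtain e2 where "e2 > 0" and e2: "\<forall>y\<in>cball b e2. h y = h b \<longrightarrow> y = b"
      using isolated[of b] eq nz by auto
    \<comment> \<open>Small enough for isolation at both points; the bound by half the distance
      makes the two open balls disjoint.\<close>
    define r where "r = Min {e1, e2, dist a b / 2}"
    have "r > 0" and r: "r \<le> e1" "r \<le> e2" "r \<le> dist a b / 2"
      using \<open>e1 > 0\<close> \<open>e2 > 0\<close> \<open>a \<noteq> b\<close> by (auto simp: r_def)
    have "\<forall>\<^sub>F t in at_right 0. h a \<in> g t ` ball a r"
      using r e1 by (intro hits \<open>r > 0\<close>) auto
    moreover have "\<forall>\<^sub>F t in at_right 0. h a \<in> g t ` ball b r"
      unfolding eq using r e2 by (intro hits \<open>r > 0\<close>) auto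
    \<comment> \<open>A single \<open>t > 0\<close> serves both balls, so the injective
      \<open>g t\<close> would take the value \<open>h a\<close> in two disjoint sets.\<close>
    ultimately have "\<forall>\<^sub>F t in at_right 0. h a \<in> g t ` ball a r \<and> h a \<in> g t ` ball b r \<and> 0 < t"
      by (intro eventually_conj eventually_at_right_less)
    then obtain t where t: "h a \<in> g t ` ball a r" "h a \<in> g t ` ball b r" "0 < t"
      using eventually_happens trivial_limit_at_right_real by blast
    then have "h a \<in> g t ` (ball a r \<inter> ball b r)"
      by (simp add: image_Int[OF g_inj])
    then show False
      using disjoint_ballI[of r r a b] r by auto
  qed
  \<comment> \<open>Each direction \<open>u\<close> of a fiber gives a solution of
    \<open>h z = u\<close> on that very fiber.\<close>
  have shift: "h (foot F x + u) = u \<and> foot F x + u \<in> aplane x (F x)"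
    if "u \<in> span (range (F x))" for x u
  proof -
    have *: "foot F x + u \<in> aplane x (F x)"
      using foot_in_aplane that by (rule add_in_aplane)
    then have "foot F (foot F x + u) = foot F x"
      by (rule fibration_foot_eq[OF assms(1)])
    with * show ?thesis by (simp add: h_def)
  qed
  have "no_parallel_lines (F x) (F y)" if ne: "aplane x (F x) \<noteq> aplane y (F y)" for x y
  proof -
    have "u = 0" if u: "u \<in> span (range (F x))" "u \<in> span (range (F y))" for u
    proof (rule ccontr)
      assume "u \<noteq> 0"
      \<comment> \<open>A shared direction \<open>u\<close> gives one solution of
        \<open>h z = u\<close> on each fiber; \<open>h_inj\<close> identifies them, so the fibers
        meet.\<close>
      have "foot F x + u = foot F y + u"
        by (rule h_inj) (simp_all add: shift u \<open>u \<noteq> 0\<close>)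
      then have "foot F x + u \<in> aplane x (F x)" "foot F x + u \<in> aplane y (F y)"
        using shift[OF u(1)] shift[OF u(2)] by simp_all
      with ne show False
        using fibration_aplane_eqI[OF assms(1)] by blast
    qed
    then show ?thesis
      unfolding no_parallel_lines_def by (auto simp: span_zero)
  qed
  moreover have "aplane x (F x) \<inter> aplane y (F y) = {}" if "aplane x (F x) \<noteq> aplane y (F y)" for x y
    using fibration_aplane_eqI[OF assms(1)] that by blast
  ultimately show ?thesis
    unfolding skew_fibration_def by simp
qed

end
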